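(* There exist two real sequences $(a_n)_{n\in\mathbb{N}}$ and $(b_n)_{n\in\mathbb{N}}$, where $\mathbb{N}=\{0,1,2,\ldots\}$, such that for all $n\in\mathbb{N}$ $$\beta_n^{(1)}=b_n e^{\pi i/3},\qquad (\gamma_n^{(1)})^2=a_n e^{-\pi i/3},$$ and $a_n,b_n$ satisfy the coupled difference relations $$a_n+a_{n+1}=b_n^2\quad (n\ge 0),\qquad 3a_n(b_n+b_{n-1})=n\quad (n\ge 1),$$ with initial conditions $$a_0=0,\qquad b_0=\frac{\Gamma(2/3)}{\Gamma(1/3)}.$$ Similarly, with the same sequences $(a_n)$ and $(b_n)$, for all $n\in\mathbb{N}$ $$\beta_n^{(2)}=b_n e^{-\pi i/3},\qquad (\gamma_n^{(2)})^2=a_n e^{\pi i/3}.$$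
   Context: Let $\omega=e^{2\pi i/3}$ and, for $k=0,1,2$, let $\Gamma_k=\{r\omega^k: r\ge 0\}$ be the closed ray in $\mathbb{C}$ from the origin in direction $\omega^k$. All rays are oriented from left to right, so $\Gamma_0$ goes from $0$ to $+\infty$, while $\Gamma_1,\Gamma_2$ go from infinity to $0$. Thus for $j=1,2$ $$\int_{\Gamma_0\cup\Gamma_j} f(x)\,dx=\int_0^\infty f(t)\,dt-\omega^j\int_0^\infty f(\omega^j t)\,dt .$$ For $j=1,2$, $(p_n^{(j)})_{n\in\mathbb{N}}$ is the sequence of monic polynomials, $\deg p_n^{(j)}=n$, with $$\int_{\Gamma_0\cup\Gamma_j}p_n^{(j)}(x)x^k e^{-x^3}\,dx=0,\qquad k=0,1,\ldots,n-1.$$ Standing assumption: for every $n$ such a monic polynomial of degree $n$ exists and is unique, equivalently $\int_{\Gamma_0\cup\Gamma_j}(p_n^{(j)}(x))^2e^{-x^3}dx\neq 0$ for every $n$. The numbers $\beta_n^{(j)}$ and $(\gamma_n^{(j)})^2$ are the coefficients of the three-term recurrence relation $$x p_n^{(j)}(x)=p_{n+1}^{(j)}(x)+\beta_n^{(j)}p_n^{(j)}(x)+(\gamma_n^{(j)})^2p_{n-1}^{(j)}(x),\qquad n\ge 0,$$ with $(\gamma_0^{(j)})^2=0$ and $p_{-1}^{(j)}=0$; explicitly $$\beta_n^{(j)}=\frac{\int_{\Gamma_0\cup\Gamma_j} x (p_n^{(j)}(x))^2e^{-x^3}dx}{\int_{\Gamma_0\cup\Gamma_j} (p_n^{(j)}(x))^2e^{-x^3}dx},\qquad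 (\gamma_n^{(j)})^2=\frac{\int_{\Gamma_0\cup\Gamma_j} x p_n^{(j)}(x)p_{n-1}^{(j)}(x)e^{-x^3}dx}{\int_{\Gamma_0\cup\Gamma_j} (p_{n-1}^{(j)}(x))^2e^{-x^3}dx}\quad(n\ge1).$$ *)

theory Defs
  imports
    "HOL-Analysis.Analysis"
    "HOL-Computational_Algebra.Polynomial"
    "HOL-Real_Asymp.Real_Asymp"
begin

definition omega :: complex where
  "omega = exp (2 * of_real pi * \<i> / 3)"

text \<open>
  The integral over the union of the ray from \<open>0\<close> in direction \<open>1\<close>, traversed outwards, and the
  ray from \<open>0\<close> in direction \<open>omega ^ j\<close>, traversed inwards. The integrals are
  Henstock--Kurzweil integrals over the half-line; for the integrands used below, polynomials
  times \<open>exp (- x ^ 3)\<close>, they converge absolutely (see \<open>weighted_poly_absolutely_integrable\<close>).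
\<close>

definition rays_integral :: "nat \<Rightarrow> (complex \<Rightarrow> complex) \<Rightarrow> complex" where
  "rays_integral j f =
     integral {0..} (\<lambda>t::real. f (of_real t))
     - omega ^ j * integral {0..} (\<lambda>t::real. f (omega ^ j * of_real t))"

definition is_monic_orth_poly :: "nat \<Rightarrow> nat \<Rightarrow> complex poly \<Rightarrow> bool" where
  "is_monic_orth_poly j n p \<longleftrightarrow>
     degree p = n \<and> lead_coeff p = 1 \<and>
     (\<forall>k<n. rays_integral j (\<lambda>x. poly p x * x ^ k * exp (- (x ^ 3))) = 0)"

definition orth_poly :: "nat \<Rightarrow> nat \<Rightarrow> complex poly" where
  "orth_poly j n = (THE p. is_monic_orth_poly j n p)"

text \<open>
  The coefficients of the three-term recurrence, given by their integral formulas. That they do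
  satisfy the recurrence (and are the only numbers to do so) is shown in
  \<open>three_term_recurrence\<close> and \<open>recurrence_coeffs_unique\<close>. Note that \<open>gamma2 j n\<close> stands for
  the square of the recurrence coefficient gamma.
\<close>

definition beta :: "nat \<Rightarrow> nat \<Rightarrow> complex" where
  "beta j n =
     rays_integral j (\<lambda>x. x * (poly (orth_poly j n) x)\<^sup>2 * exp (- (x ^ 3))) /
     rays_integral j (\<lambda>x. (poly (orth_poly j n) x)\<^sup>2 * exp (- (x ^ 3)))"

definition gamma2 :: "nat \<Rightarrow> nat \<Rightarrow> complex" where
  "gamma2 j n =
     (if n = 0 then 0
      else rays_integral j
             (\<lambda>x. x * poly (orth_poly j n) x * poly (orth_poly j (n - 1)) x * exp (- (x ^ 3))) /
           rays_integral j (\<lambda>x. (poly (orth_poly j (n - 1)) x)\<^sup>2 * exp (- (x ^ 3))))"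


lemma omega_pow_cubed: "(omega ^ j) ^ 3 = 1"
proof -
  have "omega ^ 3 = 1"
    using exp_two_pi_i by (simp add: omega_def mult_ac flip: exp_of_nat_mult)
  then show ?thesis
    by (metis power_mult mult.commute power_one)
qed

lemma power_exp_cube_integrable: "(\<lambda>t::real. t ^ k * exp (- (t ^ 3))) absolutely_integrable_on {0..}"
proof -
  let ?f = "\<lambda>t::real. t ^ k * exp (- (t ^ 3))"
  let ?g = "\<lambda>t::real. t ^ k * exp (t - t ^ 3)"
  have "(?g \<longlongrightarrow> 0) at_top"
    by real_asymp
  then have "\<forall>\<^sub>F t in at_top. ?g t < 1"
    by (rule order_tendstoD) simp
  then obtain T where T: "\<And>t. t \<ge> T \<Longrightarrow> ?g t < 1"
    by (auto simp: eventually_at_top_linorder)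
  have "bounded (?g ` {0..T})"
    by (intro compact_imp_bounded compact_continuous_image continuous_intros) auto
  then obtain B where B: "\<And>t. t \<in> {0..T} \<Longrightarrow> \<bar>?g t\<bar> \<le> B"
    unfolding bounded_iff real_norm_def by blast
  define C where "C = max 1 B"
  have g: "?g t \<le> C" if "t \<ge> 0" for t
    using T[of t] B[of t] that unfolding C_def by (cases "t \<ge> T") auto
  have bound: "?f t \<le> C * exp (-1 * t)" if "t \<ge> 0" for t
  proof -
    have "?f t = ?g t * exp (-1 * t)"
      by (simp flip: exp_add)
    also have "\<dots> \<le> C * exp (-1 * t)"
      using g[OF that] by (intro mult_right_mono) auto
    finally show ?thesis .
  qed
  have meas: "?f \<in> borel_measurable (lebesgue_on {0..})"
    by (intro continuous_imp_measurable_on_sets_lebesgue continuous_intros) auto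
  have int: "(\<lambda>t. C * exp (-1 * t)) integrable_on {0..}"
    by (intro integrable_on_mult_right integrable_on_exp_minus_to_infinity) auto
  have "?f integrable_on {0..}"
    by (rule measurable_bounded_by_integrable_imp_integrable[OF meas int])
       (use bound in auto)
  then show ?thesis
    by (intro nonnegative_absolutely_integrable_1) auto
qed

lemma weighted_poly_absolutely_integrable:
  assumes "w ^ 3 = (1::complex)"
  shows "(\<lambda>t. poly q (w * of_real t) * exp (- ((w * of_real t) ^ 3))) absolutely_integrable_on {0..}"
proof -
  have "(\<lambda>t. \<Sum>i\<le>degree q. (coeff q i * w ^ i) * of_real (t ^ i * exp (- (t ^ 3))))
          absolutely_integrable_on {0..}"
  proof (intro absolutely_integrable_sum)
    fix i
    have "bounded_linear (\<lambda>x::real. (coeff q i * w ^ i) * of_real x)"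
      by (intro bounded_linear_const_mult bounded_linear_of_real)
    from absolutely_integrable_linear[OF power_exp_cube_integrable this, of i]
    show "(\<lambda>t. coeff q i * w ^ i * of_real (t ^ i * exp (- (t ^ 3)))) absolutely_integrable_on {0..}"
      by (simp add: o_def)
  qed auto
  moreover have "(\<lambda>t. \<Sum>i\<le>degree q. (coeff q i * w ^ i) * of_real (t ^ i * exp (- (t ^ 3))))
      = (\<lambda>t. poly q (w * of_real t) * exp (- ((w * of_real t) ^ 3)))"
    using assms
    by (intro ext, simp add: poly_altdef power_mult_distrib exp_of_real flip: of_real_power of_real_minus)
       (simp add: sum_distrib_left mult_ac)
  ultimately show ?thesis
    by simp
qed

definition moment_functional :: "nat \<Rightarrow> complex poly \<Rightarrow> complex" where
  "moment_functional j q = rays_integral j (\<lambda>x. poly q x * exp (- (x ^ 3)))"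

lemma weighted_poly_integrable:
  assumes "w ^ 3 = (1::complex)"
  shows "(\<lambda>t. poly q (w * of_real t) * exp (- ((w * of_real t) ^ 3))) integrable_on {0..}"
  using weighted_poly_absolutely_integrable[OF assms] set_lebesgue_integral_eq_integral(1) by blast

lemma moment_functional_add:
  "moment_functional j (p + q) = moment_functional j p + moment_functional j q"
proof -
  have "integral {0..} (\<lambda>t. poly (p + q) (w * of_real t) * exp (- ((w * of_real t) ^ 3)))
      = integral {0..} (\<lambda>t. poly p (w * of_real t) * exp (- ((w * of_real t) ^ 3)))
        + integral {0..} (\<lambda>t. poly q (w * of_real t) * exp (- ((w * of_real t) ^ 3)))"
    if "w ^ 3 = 1" for w
    using weighted_poly_integrable[OF that] by (simp add: distrib_right integral_add)
  from this[of 1] this[of "omega ^ j"] show ?thesis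
    by (simp add: moment_functional_def rays_integral_def omega_pow_cubed algebra_simps)
qed

lemma moment_functional_smult:
  "moment_functional j (smult c q) = c * moment_functional j q"
  by (simp add: moment_functional_def rays_integral_def mult.assoc right_diff_distrib
        mult.left_commute[of _ c])

lemma moment_functional_0 [simp]: "moment_functional j 0 = 0"
  using moment_functional_smult[of j 0 0] by simp

lemma moment_functional_diff:
  "moment_functional j (p - q) = moment_functional j p - moment_functional j q"
  using moment_functional_add[of j p "smult (-1) q"] moment_functional_smult[of j "-1" q] by simp

lemma moment_functional_sum:
  "moment_functional j (\<Sum>i\<in>A. f i) = (\<Sum>i\<in>A. moment_functional j (f i))"
  by (induction A rule: infinite_finite_induct) (auto simp: moment_functional_add)

lemma is_monic_orth_poly_altdef:
  "is_monic_orth_poly j n p \<longleftrightarrow> degree p = n \<and> lead_coeff p = 1 \<and>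
     (\<forall>k<n. moment_functional j (p * monom 1 k) = 0)"
  by (simp add: is_monic_orth_poly_def moment_functional_def poly_monom)

lemma moment_functional_orth:
  assumes "\<And>k. k \<le> degree q \<Longrightarrow> moment_functional j (p * monom 1 k) = 0"
  shows "moment_functional j (p * q) = 0"
proof -
  have "p * q = (\<Sum>k\<le>degree q. smult (coeff q k) (p * monom 1 k))"
    by (subst poly_as_sum_of_monoms[of q, symmetric])
       (simp add: sum_distrib_left smult_monom flip: mult_smult_right)
  then show ?thesis
    using assms by (simp add: moment_functional_sum moment_functional_smult)
qed

context
  fixes j :: nat
  assumes ex1: "\<forall>n. \<exists>!p. is_monic_orth_poly j n p"
begin

lemma orth_poly_is_monic_orth_poly: "is_monic_orth_poly j n (orth_poly j n)"
  unfolding orth_poly_def by (rule theI') (use ex1 in auto)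

lemma degree_orth_poly [simp]: "degree (orth_poly j n) = n"
  and lead_coeff_orth_poly [simp]: "coeff (orth_poly j n) n = 1"
  using orth_poly_is_monic_orth_poly[of n] by (auto simp: is_monic_orth_poly_def)

lemma orth_poly_orth: "degree q < n \<Longrightarrow> moment_functional j (orth_poly j n * q) = 0"
  by (rule moment_functional_orth)
     (use orth_poly_is_monic_orth_poly[of n] in \<open>auto simp: is_monic_orth_poly_altdef\<close>)

lemma orth_poly_orth': "degree q < n \<Longrightarrow> moment_functional j (q * orth_poly j n) = 0"
  using orth_poly_orth[of q n] by (simp add: mult.commute)

lemma orth_imp_0:
  assumes "degree r \<le> n" "\<And>k. k \<le> n \<Longrightarrow> moment_functional j (r * monom 1 k) = 0"
  shows "r = 0"
proof -
  let ?P = "orth_poly j (Suc n)"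
  have deg: "degree (?P + r) = Suc n"
    using assms(1) by (subst degree_add_eq_left) auto
  moreover have "coeff (?P + r) (Suc n) = 1"
    using assms(1) by (simp add: coeff_eq_0)
  moreover have "moment_functional j ((?P + r) * monom 1 k) = 0" if "k < Suc n" for k
    using that assms(2)[of k] orth_poly_is_monic_orth_poly[of "Suc n"]
    by (simp add: distrib_right moment_functional_add is_monic_orth_poly_altdef)
  ultimately have "is_monic_orth_poly j (Suc n) (?P + r)"
    by (simp add: is_monic_orth_poly_altdef)
  with orth_poly_is_monic_orth_poly[of "Suc n"] ex1 have "?P + r = ?P"
    by blast
  then show ?thesis by simp
qed

lemma orth_poly_pred:
  assumes "degree r \<le> n" "\<And>k. k < n \<Longrightarrow> moment_functional j (r * monom 1 k) = 0"
    and "moment_functional j (r * orth_poly j n) = 0"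
  shows "r = 0"
proof (rule orth_imp_0[OF assms(1)])
  let ?q = "monom 1 n - orth_poly j n"
  fix k assume "k \<le> n"
  have "moment_functional j (r * ?q) = 0"
  proof (cases "?q = 0")
    case False
    have le: "degree ?q \<le> n"
      by (intro degree_diff_le) (auto simp: degree_monom_le)
    moreover have "coeff ?q n = 0" by simp
    ultimately have "degree ?q < n"
      using False by (metis le_neq_implies_less leading_coeff_0_iff)
    show ?thesis
      by (rule moment_functional_orth) (use \<open>degree ?q < n\<close> assms(2) in auto)
  qed (metis mult_zero_right moment_functional_0)
  then have "moment_functional j (r * monom 1 n) = 0"
    using assms(3) by (simp add: right_diff_distrib moment_functional_diff)
  then show "moment_functional j (r * monom 1 k) = 0"
    using assms(2)[of k] \<open>k \<le> n\<close> by (cases "k = n") auto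
qed

lemma orth_poly_norm_nz: "moment_functional j (orth_poly j n * orth_poly j n) \<noteq> 0"
proof
  assume "moment_functional j (orth_poly j n * orth_poly j n) = 0"
  then have "orth_poly j n = 0"
    using orth_poly_is_monic_orth_poly[of n]
    by (intro orth_poly_pred[of _ n]) (auto simp: is_monic_orth_poly_altdef)
  then show False
    using lead_coeff_orth_poly[of n] by simp
qed

lemma beta_altdef:
  "beta j n = moment_functional j ([:0, 1:] * orth_poly j n * orth_poly j n) /
     moment_functional j (orth_poly j n * orth_poly j n)"
  by (simp add: beta_def moment_functional_def power2_eq_square mult_ac)

lemma gamma2_Suc_altdef:
  "gamma2 j (Suc n) = moment_functional j ([:0, 1:] * orth_poly j (Suc n) * orth_poly j n) /
     moment_functional j (orth_poly j n * orth_poly j n)"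
  by (simp add: gamma2_def moment_functional_def power2_eq_square mult_ac)

theorem three_term_recurrence:
  "[:0, 1:] * orth_poly j n =
     orth_poly j (Suc n) + smult (beta j n) (orth_poly j n)
     + (if n = 0 then 0 else smult (gamma2 j n) (orth_poly j (n - 1)))"
proof -
  let ?p = "orth_poly j"
  let ?g = "if n = 0 then 0 else smult (gamma2 j n) (?p (n - 1))"
  let ?L = "moment_functional j"
  define r where "r = [:0, 1:] * ?p n - ?p (Suc n) - smult (beta j n) (?p n) - ?g"
  have "degree ([:0, 1:] * ?p n - ?p (Suc n)) \<le> n"
  proof (rule degree_le, intro allI impI)
    fix i assume "i > n"
    then show "coeff ([:0, 1:] * ?p n - ?p (Suc n)) i = 0"
      by (cases i; cases "i = Suc n") (auto simp: coeff_eq_0)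
  qed
  then have deg: "degree r \<le> n"
    unfolding r_def by (intro degree_diff_le[OF degree_diff_le]) auto
  have Lr: "?L (r * q) = ?L (?p n * ([:0, 1:] * q)) - ?L (?p (Suc n) * q)
      - beta j n * ?L (?p n * q) - ?L (?g * q)" for q
    by (simp add: r_def moment_functional_diff moment_functional_smult left_diff_distrib
         right_diff_distrib mult_ac)
  have degx: "degree ([:0, 1:] * q) \<le> Suc (degree q)" for q :: "complex poly"
    by (rule order.trans[OF degree_mult_le]) simp
  have low: "?L (r * q) = 0" if "Suc (degree q) < n" for q
  proof -
    have "?L (?p n * ([:0, 1:] * q)) = 0"
      using degx[of q] that by (intro orth_poly_orth) linarith
    moreover have "?L (?g * q) = 0"
      using that orth_poly_orth[of q "n - 1"] by (simp add: moment_functional_smult)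
    ultimately show ?thesis
      unfolding Lr using that by (simp add: orth_poly_orth)
  qed
  have "r = 0"
  proof (rule orth_poly_pred[OF deg])
    have "?L (?g * ?p n) = 0"
      using orth_poly_orth[of "?p (n - 1)" n]
      by (simp add: moment_functional_smult mult_ac)
    then show "?L (r * ?p n) = 0"
      unfolding Lr using orth_poly_norm_nz[of n]
      by (simp add: orth_poly_orth orth_poly_orth' beta_altdef mult_ac)
  next
    show "?L (r * monom 1 k) = 0" if "k < n" for k
    proof (cases n)
      case (Suc m)
      have pm: "?L (r * ?p m) = 0"
        unfolding Lr using orth_poly_norm_nz[of m] Suc
        by (simp add: orth_poly_orth orth_poly_orth' gamma2_Suc_altdef moment_functional_smult mult_ac)
      show ?thesis
      proof (cases "k = m")
        case False
        then show ?thesis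
          using that Suc by (intro low) (simp add: degree_monom_eq)
      next
        case True
        let ?q = "monom 1 m - ?p m"
        have "?L (r * ?q) = 0"
        proof (cases "?q = 0")
          case False
          have le: "degree ?q \<le> m"
            by (intro degree_diff_le) (auto simp: degree_monom_le)
          moreover have "coeff ?q m = 0" by simp
          ultimately have "degree ?q < m"
            using False by (metis le_neq_implies_less leading_coeff_0_iff)
          then show ?thesis
            using Suc by (intro low) auto
        qed (metis mult_zero_right moment_functional_0)
        then show ?thesis
          using pm True by (simp add: right_diff_distrib moment_functional_diff)
      qed
    qed (use that in auto)
  qed
  then show ?thesis
    by (simp add: r_def algebra_simps)
qed

theorem recurrence_coeffs_unique:
  assumes "[:0, 1:] * orth_poly j n =
     orth_poly j (Suc n) + smult b (orth_poly j n)
     + (if n = 0 then 0 else smult g (orth_poly j (n - 1)))"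
  shows "b = beta j n" and "n > 0 \<Longrightarrow> g = gamma2 j n"
proof -
  have eq: "smult b (orth_poly j n) + (if n = 0 then 0 else smult g (orth_poly j (n - 1)))
      = smult (beta j n) (orth_poly j n)
        + (if n = 0 then 0 else smult (gamma2 j n) (orth_poly j (n - 1)))"
    using three_term_recurrence[of n] assms by (simp add: add.assoc)
  from arg_cong[OF eq, of "\<lambda>p. coeff p n"] show b: "b = beta j n"
    by (cases "n = 0") (auto simp: coeff_eq_0)
  show "g = gamma2 j n" if "n > 0"
    using arg_cong[OF eq, of "\<lambda>p. coeff p (n - 1)"] that b by simp
qed

end

end

theory Submission
  imports Defs
begin

(* Let L be the moment functional and h n = L (p_n^2). Since exp (- x^3) has derivative
   -3 x^2 exp (- x^3), integration by parts gives L q' = 3 L (x^2 q); the boundary terms at 0 of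
   the two rays cancel. Taking q = p_n^2 and q = p_(n+1) p_n and expanding x p_n by the recurrence
   yields gamma_n^2 + gamma_(n+1)^2 = - beta_n^2 and
   3 gamma_(n+1)^2 (beta_(n+1) + beta_n) = n + 1. These equations determine all the coefficients
   from beta_0 = c Gamma(2/3) / Gamma(1/3), where c = 1 + omega^j. As c^3 = -1, scaling beta by c
   and gamma^2 by - c^2 = 1 / c turns them into equations with real coefficients. *)

section \<open>Moments of the weight and integration by parts\<close>

lemma integral_power_exp_cube:
  "integral {0..} (\<lambda>t::real. t ^ k * exp (- (t ^ 3))) = Gamma (real (k + 1) / 3) / 3"
proof -
  define x where "x = real (k + 1) / 3"
  have x: "x > 0"
    by (simp add: x_def)
  define f where "f = (\<lambda>t::real. t powr (x - 1) / exp t)"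
  have int: "(f has_integral Gamma x) {0..}"
    unfolding f_def by (rule Gamma_integral_real[OF x])
  have img: "(\<lambda>t::real. t ^ 3) ` {0..} = {0..}"
  proof (intro equalityI subsetI)
    fix y :: real assume "y \<in> {0..}"
    then show "y \<in> (\<lambda>t. t ^ 3) ` {0..}"
      by (intro image_eqI[of _ _ "root 3 y"]) auto
  qed auto
  have "f absolutely_integrable_on {0..}"
    using int by (intro nonnegative_absolutely_integrable_1) (auto simp: f_def integrable_on_def)
  then have "f absolutely_integrable_on (\<lambda>t. t ^ 3) ` {0..} \<and>
      integral ((\<lambda>t. t ^ 3) ` {0..}) f = Gamma x"
    using int by (simp add: img integral_unique)
  \<comment> \<open>Substitute \<open>t ^ 3\<close> in Euler's integral for Gamma at (k + 1) /
    3.\<close>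
  then have "integral {0..} (\<lambda>t. \<bar>3 * t ^ 2\<bar> * f (t ^ 3)) = Gamma x"
    by (subst (asm) has_absolute_integral_change_of_variables_1'[symmetric])
       (auto intro!: derivative_eq_intros inj_onI dest: power_eq_imp_eq_base)
  also have "integral {0..} (\<lambda>t. \<bar>3 * t ^ 2\<bar> * f (t ^ 3))
      = integral {0..} (\<lambda>t. 3 * (t ^ k * exp (- (t ^ 3))))"
  \<comment> \<open>For k = 0 the two integrands differ at t = 0: one is 0, the other 3.\<close>
  proof (rule integral_spike[of "{0}"])
    fix t :: real assume "t \<in> {0..} - {0}"
    then have t: "t > 0" by auto
    have "t ^ 2 * (t ^ 3) powr (x - 1) = t powr 2 * t powr (3 * (x - 1))"
      using t by (simp add: powr_powr flip: powr_numeral)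
    also have "\<dots> = t powr real k"
      by (simp add: x_def field_simps flip: powr_add)
    also have "\<dots> = t ^ k"
      using t by (rule powr_realpow)
    finally show "3 * (t ^ k * exp (- (t ^ 3))) = \<bar>3 * t ^ 2\<bar> * f (t ^ 3)"
      by (simp add: f_def exp_minus field_simps)
  qed auto
  finally show ?thesis
    by (simp add: x_def)
qed

lemma omega_powers: "omega = -1/2 + sqrt 3 / 2 * \<i>" "omega ^ 2 = -1/2 - sqrt 3 / 2 * \<i>"
proof -
  show omega: "omega = -1/2 + sqrt 3 / 2 * \<i>"
    using cos_120 sin_120 by (simp add: omega_def exp_eq_polar cis.ctr complex_eq_iff)
  show "omega ^ 2 = -1/2 - sqrt 3 / 2 * \<i>"
    unfolding omega power2_eq_square by (simp add: complex_eq_iff)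
qed

text \<open>On a ray x = w t with w^3 = 1 the weight is the real one, so only w^k comes out of the
  integral; the factor \<open>omega ^ j\<close> in \<open>rays_integral\<close> raises the exponent
  to k + 1.\<close>

lemma moment_functional_monom:
  "moment_functional j (monom 1 k) =
     (1 - omega ^ (j * (k + 1))) * of_real (Gamma (real (k + 1) / 3) / 3)"
proof -
  have "integral {0..} (\<lambda>t. poly (monom 1 k) (w * of_real t) * exp (- ((w * of_real t) ^ 3)))
      = w ^ k * of_real (Gamma (real (k + 1) / 3) / 3)" if w: "w ^ 3 = 1" for w :: complex
  proof -
    have "(\<lambda>t. poly (monom 1 k) (w * of_real t) * exp (- ((w * of_real t) ^ 3)))
        = (\<lambda>t. w ^ k * of_real (t ^ k * exp (- (t ^ 3))))"
      using w by (intro ext) (simp add: poly_monom power_mult_distrib exp_of_real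
          flip: of_real_power of_real_minus)
    moreover have "(\<lambda>t::real. t ^ k * exp (- (t ^ 3))) integrable_on {0..}"
      using power_exp_cube_integrable set_lebesgue_integral_eq_integral(1) by blast
    then have "integral {0..} (\<lambda>t. of_real (t ^ k * exp (- (t ^ 3))))
        = (of_real (Gamma (real (k + 1) / 3) / 3) :: complex)"
      by (metis has_integral_of_real integrable_integral integral_unique integral_power_exp_cube)
    ultimately show ?thesis
      by simp
  qed
  note ray = this
  have "moment_functional j (monom 1 k) = (1 - omega ^ j * (omega ^ j) ^ k) *
      of_real (Gamma (real (k + 1) / 3) / 3)"
    using ray[of 1] unfolding moment_functional_def rays_integral_def ray[OF omega_pow_cubed]
    by (simp add: left_diff_distrib)
  then show ?thesis
    by (simp add: power_add power_mult)
qed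

text \<open>By linearity monomials suffice. The root-of-unity factors of the moments have period 3
  in the exponent, so on x^k the claim reduces to Gamma(s + 1) = s Gamma(s) with s = k / 3.\<close>

lemma moment_functional_pderiv:
  "moment_functional j (pderiv q) = 3 * moment_functional j ([:0, 1:] * [:0, 1:] * q)"
proof -
  have monom: "moment_functional j (pderiv (monom 1 k)) = 3 * moment_functional j (monom 1 (k + 2))"
    for k
  \<comment> \<open>At k = 0 Gamma(k / 3) has a pole. Here the derivative is 0, and the moment of
    x^2 vanishes because \<open>omega ^ (j * 3) = 1\<close>; this is the cancellation of the
    boundary terms.\<close>
  proof (cases k)
    case 0
    have "omega ^ (j * 3) = 1"
      using omega_pow_cubed[of j] by (simp add: power_mult)
    with 0 show ?thesis
      using moment_functional_monom[of j 2] by (simp add: pderiv_monom eval_nat_numeral)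
  next
    case (Suc m)
    have "omega ^ (j * (k + 3)) = omega ^ (j * k) * (omega ^ j) ^ 3"
      by (simp add: algebra_simps flip: power_add power_mult)
    then have w: "omega ^ (j * (k + 3)) = omega ^ (j * k)"
      by (simp add: omega_pow_cubed)
    have "Gamma (real k / 3 + 1) = real k / 3 * Gamma (real k / 3)"
      using Suc by (intro Gamma_plus1) (auto dest: nonpos_Ints_nonpos)
    then have G: "Gamma (real (k + 3) / 3) = real k / 3 * Gamma (real k / 3)"
      by (simp add: add_divide_distrib)
    have "pderiv (monom 1 k) = smult (of_nat k) (monom (1::complex) m)"
      using Suc by (simp add: pderiv_monom smult_monom)
    then have "moment_functional j (pderiv (monom 1 k)) =
        of_nat k * ((1 - omega ^ (j * k)) * of_real (Gamma (real k / 3) / 3))"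
      using Suc by (simp add: moment_functional_smult moment_functional_monom)
    also have "\<dots> = 3 * ((1 - omega ^ (j * (k + 3))) * of_real (Gamma (real (k + 3) / 3) / 3))"
      unfolding w G by simp
    also have "\<dots> = 3 * moment_functional j (monom 1 (k + 2))"
      by (simp add: moment_functional_monom eval_nat_numeral)
    finally show ?thesis .
  qed
  have q: "q = (\<Sum>k\<le>degree q. smult (coeff q k) (monom 1 k))"
    by (simp add: smult_monom poly_as_sum_of_monoms)
  have "pderiv q = (\<Sum>k\<le>degree q. smult (coeff q k) (pderiv (monom 1 k)))"
    by (subst q) (simp add: higher_pderiv_sum[of 1, simplified] pderiv_smult)
  moreover have "[:0, 1:] * [:0, 1:] * q = (\<Sum>k\<le>degree q. smult (coeff q k) (monom 1 (k + 2)))"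
    by (subst q) (simp add: sum_distrib_left monom_Suc)
  ultimately show ?thesis
    by (simp add: moment_functional_sum moment_functional_smult monom sum_distrib_left mult_ac)
qed

section \<open>Nonlinear relations for the recurrence coefficients\<close>

context
  fixes j :: nat
  assumes ex1: "\<forall>n. \<exists>!p. is_monic_orth_poly j n p"
begin

text \<open>Since \<open>gamma2 j 0 = 0\<close>, the last term vanishes at n = 0, where
  \<open>n - 1\<close> is 0, and no case distinction remains.\<close>

lemma orth_poly_recurrence:
  "[:0, 1:] * orth_poly j n =
     orth_poly j (Suc n) + smult (beta j n) (orth_poly j n)
     + smult (gamma2 j n) (orth_poly j (n - 1))"
  using three_term_recurrence[OF ex1, of n] by (simp add: gamma2_def)

lemma orth_poly_inner:
  "moment_functional j (orth_poly j m * orth_poly j n) =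
     (if m = n then moment_functional j (orth_poly j n * orth_poly j n) else 0)"
  using orth_poly_orth[OF ex1, of "orth_poly j n" m] orth_poly_orth'[OF ex1, of "orth_poly j m" n]
  by (cases m n rule: linorder_cases) (auto simp: degree_orth_poly[OF ex1])

text \<open>Both sides equal L (p_(n+1) x p_n): expand x p_n by the recurrence, or use the integral
  formula for \<open>gamma2\<close>. This reduces the norms below to multiples of h n, which can be
  cancelled.\<close>

lemma orth_poly_norm_Suc:
  "moment_functional j (orth_poly j (Suc n) * orth_poly j (Suc n)) =
     gamma2 j (Suc n) * moment_functional j (orth_poly j n * orth_poly j n)"
proof -
  have "moment_functional j (orth_poly j (Suc n) * ([:0, 1:] * orth_poly j n)) =
      moment_functional j (orth_poly j (Suc n) * orth_poly j (Suc n))"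
    unfolding orth_poly_recurrence[of n] distrib_left mult_smult_right moment_functional_add
      moment_functional_smult orth_poly_inner[of "Suc n" n] orth_poly_inner[of "Suc n" "n - 1"]
    by simp
  then show ?thesis
    using orth_poly_norm_nz[OF ex1, of n] by (simp add: gamma2_Suc_altdef[OF ex1] mult_ac)
qed

lemma gamma2_add_gamma2_Suc: "gamma2 j n + gamma2 j (Suc n) = - (beta j n)\<^sup>2"
proof -
  let ?p = "orth_poly j"
  define h where "h n = moment_functional j (?p n * ?p n)" for n
  have inner: "moment_functional j (?p m * ?p n) = (if m = n then h n else 0)" for m n
    unfolding h_def by (rule orth_poly_inner)
  have norm_Suc: "h (Suc n) = gamma2 j (Suc n) * h n" for n
    unfolding h_def by (rule orth_poly_norm_Suc)
  \<comment> \<open>The second alternative covers n = 0, where no degree is below n.\<close>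
  have "degree (pderiv (?p n)) < n \<or> pderiv (?p n) = 0"
    using degree_orth_poly[OF ex1, of n] by (cases n) (auto simp: degree_pderiv pderiv_eq_0_iff)
  then have "moment_functional j (?p n * pderiv (?p n)) = 0"
    using orth_poly_orth[OF ex1, of "pderiv (?p n)" n] by auto
  then have "moment_functional j (pderiv (?p n * ?p n)) = 0"
    by (simp only: pderiv_mult moment_functional_add add_0_left)
  then have "0 = moment_functional j (([:0, 1:] * ?p n) * ([:0, 1:] * ?p n))"
    unfolding moment_functional_pderiv by (simp add: mult_ac)
  also have "\<dots> = h (Suc n) + (beta j n)\<^sup>2 * h n + (gamma2 j n)\<^sup>2 * h (n - 1)"
    unfolding orth_poly_recurrence[of n] distrib_left distrib_right mult_smult_right
      mult_smult_left moment_functional_add moment_functional_smult inner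
    by (cases n) (auto simp: power2_eq_square gamma2_def)
  also have "\<dots> = (gamma2 j n + gamma2 j (Suc n) + (beta j n)\<^sup>2) * h n"
    by (cases n) (auto simp: norm_Suc gamma2_def power2_eq_square algebra_simps)
  finally show ?thesis
    using orth_poly_norm_nz[OF ex1, of n] by (simp add: h_def eq_neg_iff_add_eq_0)
qed

lemma gamma2_Suc_mult_beta: "3 * gamma2 j (Suc n) * (beta j (Suc n) + beta j n) = of_nat (Suc n)"
proof -
  let ?p = "orth_poly j"
  define h where "h n = moment_functional j (?p n * ?p n)" for n
  have inner: "moment_functional j (?p m * ?p n) = (if m = n then h n else 0)" for m n
    unfolding h_def by (rule orth_poly_inner)
  have norm_Suc: "h (Suc n) = gamma2 j (Suc n) * h n" for n
    unfolding h_def by (rule orth_poly_norm_Suc)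
  \<comment> \<open>The derivative of p_(n+1) has leading coefficient n + 1, so the difference drops
    below degree n and is orthogonal to p_n.\<close>
  let ?r = "pderiv (?p (Suc n)) - smult (of_nat (Suc n)) (?p n)"
  have "degree ?r < n \<or> ?r = 0"
  proof -
    have "degree ?r \<le> n"
      by (intro degree_diff_le) (auto simp: degree_pderiv degree_orth_poly[OF ex1])
    moreover have "coeff ?r n = 0"
      using lead_coeff_orth_poly[OF ex1, of n] lead_coeff_orth_poly[OF ex1, of "Suc n"]
      by (simp add: coeff_pderiv)
    ultimately show ?thesis
      by (metis le_neq_implies_less leading_coeff_0_iff)
  qed
  then have "moment_functional j (?p n * ?r) = 0"
    using orth_poly_orth[OF ex1, of ?r n] by auto
  then have "moment_functional j (?p n * pderiv (?p (Suc n))) = of_nat (Suc n) * h n"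
    by (simp add: right_diff_distrib moment_functional_diff moment_functional_smult h_def
        del: of_nat_Suc)
  moreover have "degree (pderiv (?p n)) < Suc n"
    by (simp add: degree_pderiv degree_orth_poly[OF ex1])
  then have "moment_functional j (?p (Suc n) * pderiv (?p n)) = 0"
    by (rule orth_poly_orth[OF ex1])
  ultimately have "of_nat (Suc n) * h n = moment_functional j (pderiv (?p n * ?p (Suc n)))"
    by (simp add: pderiv_mult moment_functional_add del: of_nat_Suc)
  also have "\<dots> = 3 * moment_functional j (([:0, 1:] * ?p (Suc n)) * ([:0, 1:] * ?p n))"
    unfolding moment_functional_pderiv by (simp add: mult_ac)
  \<comment> \<open>Only the p_(n+1) and p_n terms pair up, giving beta_(n+1) h (n+1) +
    gamma_(n+1)^2 beta_n h n.\<close>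
  also have "\<dots> = 3 * gamma2 j (Suc n) * (beta j (Suc n) + beta j n) * h n"
    unfolding orth_poly_recurrence[of n] orth_poly_recurrence[of "Suc n"] distrib_left distrib_right
      mult_smult_right mult_smult_left moment_functional_add moment_functional_smult inner
    by (cases n) (auto simp: norm_Suc gamma2_def algebra_simps)
  finally show ?thesis
    using orth_poly_norm_nz[OF ex1, of n] by (simp add: h_def)
qed

text \<open>As p_0 = 1, this is the quotient of the first two moments; 1 - omega^(2j) = (1 -
  omega^j) (1 + omega^j) gives the last factor.\<close>

lemma beta_0:
  assumes "omega ^ j \<noteq> 1"
  shows "beta j 0 = of_real (Gamma (2 / 3) / Gamma (1 / 3)) * (1 + omega ^ j)"
proof -
  have p0: "orth_poly j 0 = 1"
    using degree_orth_poly[OF ex1, of 0] lead_coeff_orth_poly[OF ex1, of 0]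
    by (metis degree_eq_zeroE lead_coeff_pCons(2) coeff_pCons_0 one_pCons)
  have L1: "moment_functional j 1 = (1 - omega ^ j) * of_real (Gamma (1 / 3) / 3)"
    using moment_functional_monom[of j 0] by (simp add: monom_0 flip: one_pCons)
  have "[:0, 1:] = monom (1::complex) 1"
    by (simp add: monom_Suc monom_0)
  then have Lx: "moment_functional j [:0, 1:] =
      (1 - omega ^ j) * ((1 + omega ^ j) * of_real (Gamma (2 / 3) / 3))"
    using moment_functional_monom[of j 1]
    by (simp add: mult_2_right power_add algebra_simps)
  have Gamma_nz: "Gamma (1 / 3 :: real) \<noteq> 0"
    using Gamma_real_pos[of "1/3"] by linarith
  show ?thesis
    unfolding beta_altdef[OF ex1] p0 mult_1_right L1 Lx using assms Gamma_nz by simp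
qed

end

section \<open>The real sequences, obtained by solving the scaled relations for the next
  terms\<close>

fun rec_coeffs :: "nat \<Rightarrow> real \<times> real" where
  "rec_coeffs 0 = (0, Gamma (2 / 3) / Gamma (1 / 3))"
| "rec_coeffs (Suc n) =
     (let (a, b) = rec_coeffs n; a' = b\<^sup>2 - a in (a', real (Suc n) / (3 * a') - b))"

text \<open>Keeping c abstract lets one induction serve both values of j. The nonvanishing clause
  ensures that \<open>rec_coeffs\<close> never divides by zero.\<close>

lemma recurrence_coeffs_eq:
  assumes ex1: "\<forall>n. \<exists>!p. is_monic_orth_poly j n p"
    and j: "omega ^ j \<noteq> 1" and c: "c = 1 + omega ^ j" "c ^ 3 = -1"
  shows "gamma2 j n = - of_real (fst (rec_coeffs n)) * c\<^sup>2 \<and>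
    beta j n = of_real (snd (rec_coeffs n)) * c \<and> (n > 0 \<longrightarrow> fst (rec_coeffs n) \<noteq> 0)"
proof (induction n)
  case 0
  show ?case
    using beta_0[OF ex1 j] by (simp add: gamma2_def c)
next
  case (Suc n)
  obtain a b where ab: "rec_coeffs n = (a, b)"
    by fastforce
  define a' where "a' = b\<^sup>2 - a"
  have rec: "rec_coeffs (Suc n) = (a', real (Suc n) / (3 * a') - b)"
    by (simp add: ab a'_def)
  have g: "gamma2 j (Suc n) = - of_real a' * c\<^sup>2"
    using gamma2_add_gamma2_Suc[OF ex1, of n] Suc.IH
    by (simp add: ab a'_def algebra_simps power_mult_distrib eq_neg_iff_add_eq_0)
  have eq: "3 * gamma2 j (Suc n) * (beta j (Suc n) + beta j n) = of_nat (Suc n)"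
    by (rule gamma2_Suc_mult_beta[OF ex1])
  \<comment> \<open>Otherwise the left side of \<open>eq\<close> would be 0, but it is n +
    1.\<close>
  then have a': "a' \<noteq> 0"
    using g by (auto simp del: of_nat_Suc)
  have c0: "c \<noteq> 0"
    using c by auto
  have "3 * of_real a' * (beta j (Suc n) + beta j n) = of_nat (Suc n) * c"
  proof -
    \<comment> \<open>Multiplying \<open>eq\<close> by c turns the factor -c^2 of
      \<open>gamma2\<close> into -c^3 = 1.\<close>
    have "of_nat (Suc n) * c = - (c ^ 3) * (3 * of_real a' * (beta j (Suc n) + beta j n))"
      unfolding eq[symmetric] g by (simp add: power2_eq_square power3_eq_cube)
    then show ?thesis
      by (simp add: c(2))
  qed
  then have "beta j (Suc n) = of_nat (Suc n) * c / (3 * of_real a') - beta j n"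
    using a' by (simp add: field_simps)
  then have "beta j (Suc n) = of_real (real (Suc n) / (3 * a') - b) * c"
    using Suc.IH by (simp add: ab algebra_simps)
  then show ?case
    using g a' by (simp add: rec del: rec_coeffs.simps)
qed

theorem proposition1p1:
  assumes ex1: "\<forall>j\<in>{1, 2}. \<forall>n. \<exists>!p. is_monic_orth_poly j n p"
  shows "\<exists>a b :: nat \<Rightarrow> real.
      (\<forall>n. beta 1 n = of_real (b n) * exp (of_real pi * \<i> / 3)) \<and>
      (\<forall>n. gamma2 1 n = of_real (a n) * exp (- of_real pi * \<i> / 3)) \<and>
      (\<forall>n. a n + a (n + 1) = (b n)\<^sup>2) \<and>
      (\<forall>n\<ge>1. 3 * a n * (b n + b (n - 1)) = real n) \<and>
      a 0 = 0 \<and> b 0 = Gamma (2 / 3) / Gamma (1 / 3) \<and>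
      (\<forall>n. beta 2 n = of_real (b n) * exp (- of_real pi * \<i> / 3)) \<and>
      (\<forall>n. gamma2 2 n = of_real (a n) * exp (of_real pi * \<i> / 3))"
proof -
  define a b where "a n = fst (rec_coeffs n)" and "b n = snd (rec_coeffs n)" for n
  let ?e = "exp (of_real pi * \<i> / 3)" and ?e' = "exp (- of_real pi * \<i> / 3)"
  have e: "?e = 1/2 + sqrt 3 / 2 * \<i>" and e': "?e' = 1/2 - sqrt 3 / 2 * \<i>"
    using cos_60 sin_60 by (simp_all add: exp_eq_polar complex_eq_iff)
  have s: "sqrt 3 * sqrt 3 = 3" by simp
  \<comment> \<open>The phases of beta for j = 1, 2 are the values of c; the last two identities
    make -c^2, the phase of \<open>gamma2\<close>, the conjugate of c.\<close>
  have c: "?e = 1 + omega ^ 1" "?e' = 1 + omega ^ 2" "?e ^ 3 = -1" "?e' ^ 3 = -1"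
      "?e\<^sup>2 = - ?e'" "?e'\<^sup>2 = - ?e"
    unfolding e e' using s
    by (simp_all add: omega_powers power2_eq_square power3_eq_cube complex_eq_iff algebra_simps)
  have w: "omega ^ 1 \<noteq> 1" "omega ^ 2 \<noteq> 1"
    unfolding power_one_right omega_powers(2) by (simp_all add: omega_powers(1) complex_eq_iff)
  have j1: "gamma2 1 n = of_real (a n) * ?e' \<and> beta 1 n = of_real (b n) * ?e \<and> (n > 0 \<longrightarrow> a n \<noteq> 0)"
    for n
    using recurrence_coeffs_eq[OF _ w(1) c(1,3), of n] ex1
    unfolding c(5) minus_mult_minus a_def b_def by blast
  have j2: "gamma2 2 n = of_real (a n) * ?e \<and> beta 2 n = of_real (b n) * ?e'" for n
    using recurrence_coeffs_eq[OF _ w(2) c(2,4), of n] ex1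
    unfolding c(6) minus_mult_minus a_def b_def by blast
  have a_Suc: "a n + a (n + 1) = (b n)\<^sup>2" for n
    by (simp add: a_def b_def Let_def split: prod.splits)
  have b_Suc: "b (Suc n) + b n = real (Suc n) / (3 * a (Suc n))" for n
    by (simp add: a_def b_def Let_def split: prod.splits)
  \<comment> \<open>Clearing the denominator in \<open>b_Suc\<close> uses that a n is nonzero, from
    \<open>j1\<close>.\<close>
  have ab: "3 * a n * (b n + b (n - 1)) = real n" if "n \<ge> 1" for n
    using that b_Suc[of "n - 1"] j1[of n] by (simp add: field_simps)
  have "a 0 = 0" "b 0 = Gamma (2 / 3) / Gamma (1 / 3)"
    by (simp_all add: a_def b_def)
  with j1 j2 a_Suc ab show ?thesis
    by blast
qed

end
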